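(* Let $P:=R_1\cup\ldots\cup R_n$ be a well-moded general logic program such that $R_n\sqsupset\ldots\sqsupset R_1$ is a hierarchy, and let $|\ |_1,\ldots,|\ |_n$ be moded level mappings for $R_1,\ldots,R_n$, respectively. Then every well-moded query is strongly bounded with respect to $P$ and $|\ |_1,\ldots,|\ |_n$.
   Context: **Programs.** All programs and queries are over a fixed first-order language with at least one constant. A literal is an atom or a negated atom. A (general) clause is $H\leftarrow L_1,\ldots,L_n$ ($n\ge 0$), $H$ an atom, $L_i$ literals. A (general) query is a finite, possibly empty, sequence of literals. A (general) program is a finite set of clauses. $\mathit{rel}(L)$ is the predicate symbol of $L$. $B_P$ is the set of ground atoms whose predicate symbol occurs in $P$. **LDNF-resolution (leftmost selection rule).** For a program $P$ and a non-empty query $Q=L,\mathbf{L}$: (i) if $L=A$ is an atom, the resolvents of $Q$ are the queries $(\mathbf{B},\mathbf{L})\theta$ for $H\leftarrow\mathbf{B}$ a variant of a clause of $P$ renamed apart from $Q$ and $\theta=\mathrm{mgu}(A,H)$; (ii) if $L=\neg A$ with $A$ ground, a subsidiary LDNF-tree for $P\cup\{A\}$ is constructed; if this tree is finite and finitely failed, $Q$ has the single resolvent $\mathbf{L}$; if it is finite and has a successful branch, $Q$ fails; if its construction diverges, the derivation containing $Q$ is considered infinite; (iii) if $L=\neg A$ with $A$ non-ground, the derivation flounders: it ends with no resolvent. A branch is successful if it ends in the empty query; it is failed if it ends in a query whose first literal is positive with no resolvent, or negative and ground with a finite subsidiary tree having a successful branch. A tree is finitely failed if it is finite and all its branches are failed.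 The LDNF-descendants of $P\cup\{Q\}$ are all queries occurring during LDNF-resolution of $P\cup\{Q\}$, including $Q$ itself and all queries occurring in the construction of all (nested) subsidiary LDNF-trees (including their roots). $\mathit{first}(Q)$ is the first literal of a non-empty query, and $\mathit{Call}_P(Q)=\{\mathit{first}(Q') : Q' \text{ a (non-empty) LDNF-descendant of } P\cup\{Q\}\}$. **Modes.** A mode for an $n$-ary predicate $p$ is a function $m_p:\{1,\ldots,n\}\to\{+,-\}$; $i$ is an input position if $m_p(i)=+$ and an output position if $m_p(i)=-$. Every predicate symbol has a fixed unique mode. A literal (positive or negative) is written $p(\mathbf{s},\mathbf{t})$ with $\mathbf{s}$ the terms in the input positions and $\mathbf{t}$ those in the output positions. A query $p_1(\mathbf{s}_1,\mathbf{t}_1),\ldots,p_n(\mathbf{s}_n,\mathbf{t}_n)$ is well-moded if $\mathit{Var}(\mathbf{s}_i)\subseteq\bigcup_{j=1}^{i-1}\mathit{Var}(\mathbf{t}_j)$ for all $i\in\{1,\ldots,n\}$. A clause $p(\mathbf{t}_0,\mathbf{s}_{n+1})\leftarrow p_1(\mathbf{s}_1,\mathbf{t}_1),\ldots,p_n(\mathbf{s}_n,\mathbf{t}_n)$ (where $\mathbf{t}_0$ are the input terms and $\mathbf{s}_{n+1}$ the output terms of the head) is well-moded if $\mathit{Var}(\mathbf{s}_i)\subseteq\bigcup_{j=0}^{i-1}\mathit{Var}(\mathbf{t}_j)$ for all $i\in\{1,\ldots,n+1\}$. A program is well-moded if all its clauses are. **Level mappings, boundedness.** A level mapping for $P$ is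 a function $|\ |:B_P\to\mathbf{N}$, extended to ground literals by $|\neg A|=|A|$. It is a moded level mapping if $|p(\mathbf{s},\mathbf{t})|=|p(\mathbf{s},\mathbf{u})|$ for all $p$ and all (ground) $\mathbf{s},\mathbf{t},\mathbf{u}$. An atom $A$ is bounded w.r.t. $|\ |$ if $\{|A'| : A' \text{ a ground instance of } A\}$ is finite. **Hierarchy.** A relation is defined in $P$ if it occurs in the head of a clause of $P$; a literal $L$ is defined in $P$ if $\mathit{rel}(L)$ is. $P$ extends $R$, written $P\sqsupset R$, if no relation defined in $P$ occurs in $R$. $R_n\sqsupset\cdots\sqsupset R_1$ is a hierarchy if $R_{i+1}\sqsupset(R_1\cup\cdots\cup R_i)$ for all $i\in\{1,\ldots,n-1\}$. **Strong boundedness.** For such a hierarchy with $P=R_1\cup\ldots\cup R_n$ and level mappings $|\ |_i$ for $R_i$, a query $Q$ is strongly bounded w.r.t. $P$ and $|\ |_1,\ldots,|\ |_n$ if for all atoms $A\in\mathit{Call}_P(Q)$ and all $i\in\{1,\ldots,n\}$, if $A$ is defined in $R_i$ then $A$ is bounded w.r.t. $|\ |_i$. *)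

theory Defs
  imports Main
begin

section \<open>Syntax\<close>

record ('f, 'p) language =
  fun_arity :: "'f \<Rightarrow> nat"
  pred_arity :: "'p \<Rightarrow> nat"

datatype 'f trm = Var nat | Fun 'f "'f trm list"

datatype ('f, 'p) atom = Atom (pred: 'p) (args: "'f trm list")

datatype ('f, 'p) literal = Pos (atom_of: "('f, 'p) atom") | Neg (atom_of: "('f, 'p) atom")

type_synonym ('f, 'p) query = "('f, 'p) literal list"

datatype ('f, 'p) clause = Clause (head: "('f, 'p) atom") (body: "('f, 'p) query")

type_synonym ('f, 'p) program = "('f, 'p) clause set"

fun wf_trm :: "('f, 'p) language \<Rightarrow> 'f trm \<Rightarrow> bool" where
  "wf_trm L (Var x) \<longleftrightarrow> True"
| "wf_trm L (Fun f ts) \<longleftrightarrow> length ts = fun_arity L f \<and> (\<forall>t\<in>set ts. wf_trm L t)"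

definition wf_atom :: "('f, 'p) language \<Rightarrow> ('f, 'p) atom \<Rightarrow> bool" where
  "wf_atom L A \<longleftrightarrow> length (args A) = pred_arity L (pred A) \<and> (\<forall>t\<in>set (args A). wf_trm L t)"

definition wf_query :: "('f, 'p) language \<Rightarrow> ('f, 'p) query \<Rightarrow> bool" where
  "wf_query L Q \<longleftrightarrow> (\<forall>l\<in>set Q. wf_atom L (atom_of l))"

definition wf_clause :: "('f, 'p) language \<Rightarrow> ('f, 'p) clause \<Rightarrow> bool" where
  "wf_clause L c \<longleftrightarrow> wf_atom L (head c) \<and> wf_query L (body c)"

definition wf_program :: "('f, 'p) language \<Rightarrow> ('f, 'p) program \<Rightarrow> bool" where
  "wf_program L P \<longleftrightarrow> finite P \<and> (\<forall>c\<in>P. wf_clause L c)"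

fun vars_trm :: "'f trm \<Rightarrow> nat set" where
  "vars_trm (Var x) = {x}"
| "vars_trm (Fun f ts) = (\<Union>t\<in>set ts. vars_trm t)"

definition vars_atom :: "('f, 'p) atom \<Rightarrow> nat set" where
  "vars_atom A = (\<Union>t\<in>set (args A). vars_trm t)"

definition vars_query :: "('f, 'p) query \<Rightarrow> nat set" where
  "vars_query Q = (\<Union>l\<in>set Q. vars_atom (atom_of l))"

definition vars_clause :: "('f, 'p) clause \<Rightarrow> nat set" where
  "vars_clause c = vars_atom (head c) \<union> vars_query (body c)"

definition ground :: "('f, 'p) atom \<Rightarrow> bool" where
  "ground A \<longleftrightarrow> vars_atom A = {}"

definition rels :: "('f, 'p) program \<Rightarrow> 'p set" where
  "rels P = (\<Union>c\<in>P. insert (pred (head c)) ((\<lambda>l. pred (atom_of l)) ` set (body c)))"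

definition defined_rels :: "('f, 'p) program \<Rightarrow> 'p set" where
  "defined_rels P = (\<lambda>c. pred (head c)) ` P"

definition herbrand_base :: "('f, 'p) language \<Rightarrow> ('f, 'p) program \<Rightarrow> ('f, 'p) atom set" where
  "herbrand_base L P = {A. wf_atom L A \<and> ground A \<and> pred A \<in> rels P}"


section \<open>Substitutions and unification\<close>

text \<open>Substitutions have finite domain and map variables to terms of the language.\<close>

type_synonym 'f subst = "nat \<Rightarrow> 'f trm"

definition substs :: "('f, 'p) language \<Rightarrow> 'f subst set" where
  "substs L = {\<sigma>. finite {x. \<sigma> x \<noteq> Var x} \<and> (\<forall>x. wf_trm L (\<sigma> x))}"

fun subst_trm :: "'f subst \<Rightarrow> 'f trm \<Rightarrow> 'f trm" where
  "subst_trm \<sigma> (Var x) = \<sigma> x"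
| "subst_trm \<sigma> (Fun f ts) = Fun f (map (subst_trm \<sigma>) ts)"

definition subst_atom :: "'f subst \<Rightarrow> ('f, 'p) atom \<Rightarrow> ('f, 'p) atom" where
  "subst_atom \<sigma> A = Atom (pred A) (map (subst_trm \<sigma>) (args A))"

fun subst_literal :: "'f subst \<Rightarrow> ('f, 'p) literal \<Rightarrow> ('f, 'p) literal" where
  "subst_literal \<sigma> (Pos A) = Pos (subst_atom \<sigma> A)"
| "subst_literal \<sigma> (Neg A) = Neg (subst_atom \<sigma> A)"

definition subst_query :: "'f subst \<Rightarrow> ('f, 'p) query \<Rightarrow> ('f, 'p) query" where
  "subst_query \<sigma> Q = map (subst_literal \<sigma>) Q"

definition subst_clause :: "'f subst \<Rightarrow> ('f, 'p) clause \<Rightarrow> ('f, 'p) clause" where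
  "subst_clause \<sigma> c = Clause (subst_atom \<sigma> (head c)) (subst_query \<sigma> (body c))"

definition variant :: "('f, 'p) language \<Rightarrow> ('f, 'p) clause \<Rightarrow> ('f, 'p) clause \<Rightarrow> bool" where
  "variant L c d \<longleftrightarrow>
     (\<exists>\<sigma>\<in>substs L. c = subst_clause \<sigma> d) \<and> (\<exists>\<tau>\<in>substs L. d = subst_clause \<tau> c)"

definition is_mgu ::
  "('f, 'p) language \<Rightarrow> 'f subst \<Rightarrow> ('f, 'p) atom \<Rightarrow> ('f, 'p) atom \<Rightarrow> bool" where
  "is_mgu L \<theta> A B \<longleftrightarrow> \<theta> \<in> substs L \<and> subst_atom \<theta> A = subst_atom \<theta> B \<and>
     (\<forall>\<tau>\<in>substs L. subst_atom \<tau> A = subst_atom \<tau> B \<longrightarrow>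
        (\<exists>\<gamma>\<in>substs L. \<forall>x. \<tau> x = subst_trm \<gamma> (\<theta> x)))"


section \<open>LDNF-resolution\<close>

text \<open>The resolvents, over all admissible variants and mgus, of a query with first literal
  \<^term>\<open>Pos A\<close> and remaining literals \<open>K\<close> using the clause \<open>c\<close>.\<close>

definition clause_resolvent ::
  "('f, 'p) language \<Rightarrow> ('f, 'p) clause \<Rightarrow> ('f, 'p) atom \<Rightarrow> ('f, 'p) query \<Rightarrow> ('f, 'p) query \<Rightarrow> bool" where
  "clause_resolvent L c A K Q' \<longleftrightarrow>
     (\<exists>d \<theta>. variant L d c \<and> vars_clause d \<inter> vars_query (Pos A # K) = {} \<and>
        is_mgu L \<theta> A (head d) \<and> Q' = subst_query \<theta> (body d @ K))"

text \<open>Finite LDNF-trees. A node carries its query, the subsidiary tree constructed for it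
  (if any) and its children. Since the datatype is inductive, all nested subsidiary
  trees are finite as well; a construction that diverges is one for which no element
  of this datatype satisfies the predicate \<open>ldnf_tree\<close> below.\<close>

datatype ('f, 'p) tree =
  Node (root: "('f, 'p) query") (subsidiary: "('f, 'p) tree option") (children: "('f, 'p) tree list")

fun successful :: "('f, 'p) tree \<Rightarrow> bool" where
  "successful (Node Q s ts) \<longleftrightarrow> Q = [] \<or> (\<exists>t\<in>set ts. successful t)"

fun failed_leaf :: "('f, 'p) query \<Rightarrow> ('f, 'p) tree option \<Rightarrow> bool" where
  "failed_leaf [] s \<longleftrightarrow> False"
| "failed_leaf (Pos A # K) s \<longleftrightarrow> True"
| "failed_leaf (Neg A # K) None \<longleftrightarrow> False"
| "failed_leaf (Neg A # K) (Some t) \<longleftrightarrow> ground A \<and> successful t"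

fun finitely_failed :: "('f, 'p) tree \<Rightarrow> bool" where
  "finitely_failed (Node Q s ts) \<longleftrightarrow>
     (if ts = [] then failed_leaf Q s else (\<forall>t\<in>set ts. finitely_failed t))"

text \<open>A query with positive first literal has one child for each clause that yields a
  resolvent. A negative ground literal whose finite subsidiary tree is not finitely failed
  has no child: it fails if that tree is successful, and otherwise (the subsidiary tree
  has floundered) the branch ends without being failed or successful.\<close>

inductive ldnf_tree :: "('f, 'p) language \<Rightarrow> ('f, 'p) program \<Rightarrow> ('f, 'p) tree \<Rightarrow> bool"
  for L :: "('f, 'p) language" and P :: "('f, 'p) program" where
  empty: "ldnf_tree L P (Node [] None [])"
| pos: "ldnf_tree L P (Node (Pos A # K) None ts)"
  if "distinct cs" and "set cs = {c \<in> P. \<exists>Q'. clause_resolvent L c A K Q'}"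
    and "list_all2 (\<lambda>c t. clause_resolvent L c A K (root t) \<and> ldnf_tree L P t) cs ts"
| neg_succeed: "ldnf_tree L P (Node (Neg A # K) (Some s) [t])"
  if "ground A" and "ldnf_tree L P s" and "root s = [Pos A]" and "finitely_failed s"
    and "ldnf_tree L P t" and "root t = K"
| neg_stop: "ldnf_tree L P (Node (Neg A # K) (Some s) [])"
  if "ground A" and "ldnf_tree L P s" and "root s = [Pos A]" and "\<not> finitely_failed s"
| flounder: "ldnf_tree L P (Node (Neg A # K) None [])"
  if "\<not> ground A"

inductive ldnf_resolvent ::
  "('f, 'p) language \<Rightarrow> ('f, 'p) program \<Rightarrow> ('f, 'p) query \<Rightarrow> ('f, 'p) query \<Rightarrow> bool"
  for L :: "('f, 'p) language" and P :: "('f, 'p) program" where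
  pos: "ldnf_resolvent L P (Pos A # K) Q'"
  if "c \<in> P" and "clause_resolvent L c A K Q'"
| neg: "ldnf_resolvent L P (Neg A # K) K"
  if "ground A" and "ldnf_tree L P s" and "root s = [Pos A]" and "finitely_failed s"

inductive_set ldnf_descendants ::
  "('f, 'p) language \<Rightarrow> ('f, 'p) program \<Rightarrow> ('f, 'p) query \<Rightarrow> ('f, 'p) query set"
  for L :: "('f, 'p) language" and P :: "('f, 'p) program" and Q :: "('f, 'p) query" where
  self: "Q \<in> ldnf_descendants L P Q"
| resolvent: "Q'' \<in> ldnf_descendants L P Q"
  if "Q' \<in> ldnf_descendants L P Q" and "ldnf_resolvent L P Q' Q''"
| subsidiary_root: "[Pos A] \<in> ldnf_descendants L P Q"
  if "Neg A # K \<in> ldnf_descendants L P Q" and "ground A"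

definition call :: "('f, 'p) language \<Rightarrow> ('f, 'p) program \<Rightarrow> ('f, 'p) query \<Rightarrow> ('f, 'p) literal set" where
  "call L P Q = hd ` (ldnf_descendants L P Q - {[]})"


section \<open>Modes\<close>

datatype io = In | Out

text \<open>Argument positions are counted from 0.\<close>

type_synonym 'p moding = "'p \<Rightarrow> nat \<Rightarrow> io"

definition positions :: "'p moding \<Rightarrow> io \<Rightarrow> ('f, 'p) atom \<Rightarrow> nat set" where
  "positions m d A = {i. i < length (args A) \<and> m (pred A) i = d}"

definition in_vars :: "'p moding \<Rightarrow> ('f, 'p) atom \<Rightarrow> nat set" where
  "in_vars m A = (\<Union>i\<in>positions m In A. vars_trm (args A ! i))"

definition out_vars :: "'p moding \<Rightarrow> ('f, 'p) atom \<Rightarrow> nat set" where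
  "out_vars m A = (\<Union>i\<in>positions m Out A. vars_trm (args A ! i))"

definition well_moded_query :: "'p moding \<Rightarrow> ('f, 'p) query \<Rightarrow> bool" where
  "well_moded_query m Q \<longleftrightarrow>
     (\<forall>i<length Q. in_vars m (atom_of (Q ! i)) \<subseteq> (\<Union>j<i. out_vars m (atom_of (Q ! j))))"

definition well_moded_clause :: "'p moding \<Rightarrow> ('f, 'p) clause \<Rightarrow> bool" where
  "well_moded_clause m c \<longleftrightarrow>
     (\<forall>i<length (body c). in_vars m (atom_of (body c ! i)) \<subseteq>
        in_vars m (head c) \<union> (\<Union>j<i. out_vars m (atom_of (body c ! j)))) \<and>
     out_vars m (head c) \<subseteq>
        in_vars m (head c) \<union> (\<Union>j<length (body c). out_vars m (atom_of (body c ! j)))"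

definition well_moded_program :: "'p moding \<Rightarrow> ('f, 'p) program \<Rightarrow> bool" where
  "well_moded_program m P \<longleftrightarrow> (\<forall>c\<in>P. well_moded_clause m c)"


section \<open>Level mappings, hierarchies and strong boundedness\<close>

text \<open>A level mapping for \<open>P\<close> is given by a total function on atoms, of which only the values
  on \<^term>\<open>herbrand_base L P\<close> are constrained or used.\<close>

type_synonym ('f, 'p) level_mapping = "('f, 'p) atom \<Rightarrow> nat"

definition moded_level_mapping ::
  "('f, 'p) language \<Rightarrow> 'p moding \<Rightarrow> ('f, 'p) program \<Rightarrow> ('f, 'p) level_mapping \<Rightarrow> bool" where
  "moded_level_mapping L m P lev \<longleftrightarrow>
     (\<forall>A\<in>herbrand_base L P. \<forall>B\<in>herbrand_base L P.
        pred A = pred B \<and> (\<forall>i\<in>positions m In A. args A ! i = args B ! i) \<longrightarrow> lev A = lev B)"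

definition bounded :: "('f, 'p) language \<Rightarrow> ('f, 'p) level_mapping \<Rightarrow> ('f, 'p) atom \<Rightarrow> bool" where
  "bounded L lev A \<longleftrightarrow> finite {lev (subst_atom \<sigma> A) |\<sigma>. \<sigma> \<in> substs L \<and> ground (subst_atom \<sigma> A)}"

definition extends :: "('f, 'p) program \<Rightarrow> ('f, 'p) program \<Rightarrow> bool" where
  "extends P R \<longleftrightarrow> defined_rels P \<inter> rels R = {}"

definition hierarchy :: "nat \<Rightarrow> (nat \<Rightarrow> ('f, 'p) program) \<Rightarrow> bool" where
  "hierarchy n R \<longleftrightarrow> (\<forall>i\<in>{1..<n}. extends (R (i + 1)) (\<Union>j\<in>{1..i}. R j))"

definition strongly_bounded ::
  "('f, 'p) language \<Rightarrow> nat \<Rightarrow> (nat \<Rightarrow> ('f, 'p) program) \<Rightarrow> (nat \<Rightarrow> ('f, 'p) level_mapping) \<Rightarrow>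
     ('f, 'p) query \<Rightarrow> bool" where
  "strongly_bounded L n R lev Q \<longleftrightarrow>
     (\<forall>A. Pos A \<in> call L (\<Union>i\<in>{1..n}. R i) Q \<longrightarrow>
        (\<forall>i\<in>{1..n}. pred A \<in> defined_rels (R i) \<longrightarrow> bounded L (lev i) A))"

end

(* Well-modedness and well-formedness are inherited by all LDNF-descendants. The input positions
   of the first literal of a well-moded query are ground, so all ground instances of a called atom
   agree on their input positions; a moded level mapping then gives them one and the same level. *)
theory Submission
  imports Defs
begin

lemma wf_trm_subst: "wf_trm L t \<Longrightarrow> \<sigma> \<in> substs L \<Longrightarrow> wf_trm L (subst_trm \<sigma> t)"
  by (induction t) (auto simp: substs_def)

lemma wf_atom_subst: "wf_atom L A \<Longrightarrow> \<sigma> \<in> substs L \<Longrightarrow> wf_atom L (subst_atom \<sigma> A)"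
  by (auto simp: wf_atom_def subst_atom_def wf_trm_subst)

lemma atom_of_subst [simp]: "atom_of (subst_literal \<sigma> l) = subst_atom \<sigma> (atom_of l)"
  by (cases l) auto

lemma wf_query_subst: "wf_query L Q \<Longrightarrow> \<sigma> \<in> substs L \<Longrightarrow> wf_query L (subst_query \<sigma> Q)"
  by (auto simp: wf_query_def subst_query_def wf_atom_subst)

lemma wf_clause_subst: "wf_clause L c \<Longrightarrow> \<sigma> \<in> substs L \<Longrightarrow> wf_clause L (subst_clause \<sigma> c)"
  by (auto simp: wf_clause_def subst_clause_def wf_atom_subst wf_query_subst)

text \<open>The variables left over when \<open>\<sigma>\<close> is applied to anything whose
  variable set is \<open>V\<close>. Since \<open>in_vars\<close> and \<open>out_vars\<close> commute
  with it, mode conditions pass to instances by monotonicity of this operator alone.\<close>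

definition subst_vars :: "'f subst \<Rightarrow> nat set \<Rightarrow> nat set" where
  "subst_vars \<sigma> V = (\<Union>x\<in>V. vars_trm (\<sigma> x))"

lemma subst_vars_empty [simp]: "subst_vars \<sigma> {} = {}"
  by (simp add: subst_vars_def)

lemma subst_vars_Un: "subst_vars \<sigma> (V \<union> W) = subst_vars \<sigma> V \<union> subst_vars \<sigma> W"
  by (simp add: subst_vars_def UN_Un)

lemma subst_vars_UN: "subst_vars \<sigma> (\<Union>i\<in>I. V i) = (\<Union>i\<in>I. subst_vars \<sigma> (V i))"
  by (auto simp: subst_vars_def)

lemma subst_vars_mono: "V \<subseteq> W \<Longrightarrow> subst_vars \<sigma> V \<subseteq> subst_vars \<sigma> W"
  by (auto simp: subst_vars_def)

lemma vars_trm_subst: "vars_trm (subst_trm \<sigma> t) = subst_vars \<sigma> (vars_trm t)"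
  by (induction t) (auto simp: subst_vars_def)

lemma subst_trm_ground: "vars_trm t = {} \<Longrightarrow> subst_trm \<sigma> t = t"
  by (induction t) (auto simp: map_idI)

lemma positions_subst [simp]: "positions m d (subst_atom \<sigma> A) = positions m d A"
  by (simp add: positions_def subst_atom_def)

lemma in_vars_subst: "in_vars m (subst_atom \<sigma> A) = subst_vars \<sigma> (in_vars m A)"
  unfolding in_vars_def positions_subst subst_vars_UN
  by (intro SUP_cong) (auto simp: positions_def subst_atom_def vars_trm_subst)

lemma out_vars_subst: "out_vars m (subst_atom \<sigma> A) = subst_vars \<sigma> (out_vars m A)"
  unfolding out_vars_def positions_subst subst_vars_UN
  by (intro SUP_cong) (auto simp: positions_def subst_atom_def vars_trm_subst)

definition query_out_vars :: "'p moding \<Rightarrow> ('f, 'p) query \<Rightarrow> nat set" where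
  "query_out_vars m Q = (\<Union>l\<in>set Q. out_vars m (atom_of l))"

lemma query_out_vars_nth: "query_out_vars m Q = (\<Union>j<length Q. out_vars m (atom_of (Q ! j)))"
  by (fastforce simp: query_out_vars_def in_set_conv_nth)

lemma query_out_vars_subst:
  "query_out_vars m (subst_query \<sigma> Q) = subst_vars \<sigma> (query_out_vars m Q)"
  by (simp add: query_out_vars_def subst_query_def subst_vars_UN out_vars_subst)

text \<open>The set \<open>V\<close> collects the variables produced to the left: \<open>{}\<close> for a query, the input
  variables of the head for a clause body.\<close>

fun well_moded_from :: "'p moding \<Rightarrow> nat set \<Rightarrow> ('f, 'p) query \<Rightarrow> bool" where
  "well_moded_from m V [] \<longleftrightarrow> True"
| "well_moded_from m V (l # Q) \<longleftrightarrow>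
     in_vars m (atom_of l) \<subseteq> V \<and> well_moded_from m (V \<union> out_vars m (atom_of l)) Q"

lemma well_moded_from_nth:
  "well_moded_from m V Q \<longleftrightarrow>
     (\<forall>i<length Q. in_vars m (atom_of (Q ! i)) \<subseteq> V \<union> (\<Union>j<i. out_vars m (atom_of (Q ! j))))"
  \<comment> \<open>Peeling off the first literal moves its outputs into \<open>V\<close>, so index
    0 is split off both from the quantifier over \<open>i\<close> and from the union over
    \<open>j\<close>.\<close>
  by (induction Q arbitrary: V)
    (simp_all add: All_less_Suc2 lessThan_Suc_eq_insert_0 Un_assoc)

lemma well_moded_query_iff: "well_moded_query m Q \<longleftrightarrow> well_moded_from m {} Q"
  by (simp add: well_moded_query_def well_moded_from_nth)

lemma well_moded_clause_iff:
  "well_moded_clause m c \<longleftrightarrow> well_moded_from m (in_vars m (head c)) (body c) \<and>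
     out_vars m (head c) \<subseteq> in_vars m (head c) \<union> query_out_vars m (body c)"
  by (simp add: well_moded_clause_def well_moded_from_nth query_out_vars_nth)

lemma well_moded_from_mono: "well_moded_from m V Q \<Longrightarrow> V \<subseteq> W \<Longrightarrow> well_moded_from m W Q"
  by (fastforce simp: well_moded_from_nth)

text \<open>Resolvents have the form \<open>body @ K\<close>; this splits their well-modedness at
  the seam, where \<open>K\<close> may also consume what the body produces.\<close>

lemma well_moded_from_append:
  "well_moded_from m V (Q @ K) \<longleftrightarrow>
     well_moded_from m V Q \<and> well_moded_from m (V \<union> query_out_vars m Q) K"
  by (induction Q arbitrary: V) (auto simp: query_out_vars_def Un_assoc)

lemma well_moded_from_subst:
  "well_moded_from m V Q \<Longrightarrow> well_moded_from m (subst_vars \<sigma> V) (subst_query \<sigma> Q)"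
proof (induction Q arbitrary: V)
  case (Cons l Q)
  have "well_moded_from m (subst_vars \<sigma> (V \<union> out_vars m (atom_of l))) (subst_query \<sigma> Q)"
    using Cons by simp
  then show ?case
    using Cons.prems by (simp add: subst_query_def in_vars_subst out_vars_subst subst_vars_Un subst_vars_mono)
qed (simp add: subst_query_def)

text \<open>Holds for every substitution, so it serves both for renaming a program clause and for
  applying the mgu to the renamed clause.\<close>

lemma well_moded_clause_subst:
  assumes "well_moded_clause m c"
  shows "well_moded_clause m (subst_clause \<sigma> c)"
  using assms subst_vars_mono[of "out_vars m (head c)" "in_vars m (head c) \<union> query_out_vars m (body c)" \<sigma>]
  by (simp add: well_moded_clause_iff subst_clause_def in_vars_subst out_vars_subst
      query_out_vars_subst subst_vars_Un well_moded_from_subst)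

text \<open>The inputs of the selected atom are ground, and unification carries this over to the
  instantiated head. The body instance is then well-moded on its own and produces every output
  variable of the head instance, which is also the instance of \<open>A\<close>; these are the
  variables that \<open>K\<close> relied on.\<close>

lemma clause_resolvent_wf_well_moded:
  assumes res: "clause_resolvent L c A K Q'"
    and c: "wf_clause L c" "well_moded_clause m c"
    and Q: "wf_query L (Pos A # K)" "well_moded_query m (Pos A # K)"
  shows "wf_query L Q' \<and> well_moded_query m Q'"
proof -
  obtain d \<theta> \<sigma> where d: "d = subst_clause \<sigma> c" and \<sigma>: "\<sigma> \<in> substs L" and \<theta>: "\<theta> \<in> substs L"
    and unif: "subst_atom \<theta> A = subst_atom \<theta> (head d)"
    and Q': "Q' = subst_query \<theta> (body d @ K)"
    using res unfolding clause_resolvent_def variant_def is_mgu_def by blast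
  have Q'_app: "Q' = subst_query \<theta> (body d) @ subst_query \<theta> K"
    by (simp add: Q' subst_query_def)
  have "wf_clause L d"
    using c \<sigma> d wf_clause_subst by blast
  then have "wf_query L (body d @ K)"
    using Q by (auto simp: wf_clause_def wf_query_def)
  then have wf: "wf_query L Q'"
    using Q' \<theta> wf_query_subst by blast
  have "well_moded_clause m (subst_clause \<theta> d)"
    using c d well_moded_clause_subst by blast
  moreover have in_A: "in_vars m A = {}" and K: "well_moded_from m (out_vars m A) K"
    using Q by (simp_all add: well_moded_query_iff)
  then have "in_vars m (subst_atom \<theta> (head d)) = {}"
    by (simp flip: unif add: in_vars_subst)
  \<comment> \<open>With no input variables left in the head, the body starts from \<open>{}\<close>
    and must account for the head outputs alone.\<close>
  ultimately have body: "well_moded_from m {} (subst_query \<theta> (body d))"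
    and out: "out_vars m (subst_atom \<theta> A) \<subseteq> query_out_vars m (subst_query \<theta> (body d))"
    by (simp_all add: well_moded_clause_iff subst_clause_def unif)
  have "well_moded_from m (out_vars m (subst_atom \<theta> A)) (subst_query \<theta> K)"
    using K by (simp add: out_vars_subst well_moded_from_subst)
  \<comment> \<open>The outputs of \<open>A\<close> are exchanged for the larger set of outputs of
    the body that replaces it.\<close>
  then have "well_moded_from m (query_out_vars m (subst_query \<theta> (body d))) (subst_query \<theta> K)"
    using out well_moded_from_mono by blast
  with body wf show ?thesis
    by (simp add: Q'_app well_moded_query_iff well_moded_from_append)
qed

lemma in_vars_ground: "ground A \<Longrightarrow> in_vars m A = {}"
  by (auto simp: ground_def vars_atom_def in_vars_def positions_def)

lemma out_vars_ground: "ground A \<Longrightarrow> out_vars m A = {}"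
  by (auto simp: ground_def vars_atom_def out_vars_def positions_def)

text \<open>Well-formedness is carried along because ground instances of a called atom must lie in
  the Herbrand base, where level mappings are constrained.\<close>

lemma ldnf_descendants_wf_well_moded:
  assumes "Q' \<in> ldnf_descendants L P Q"
    and P: "wf_program L P" "well_moded_program m P"
    and Q: "wf_query L Q" "well_moded_query m Q"
  shows "wf_query L Q' \<and> well_moded_query m Q'"
  using assms(1)
proof induction
  case self
  then show ?case using Q by simp
next
  case (resolvent Q' Q'')
  from resolvent.hyps(2) show ?case
  proof cases
    case (pos c A K)
    then have "wf_clause L c" "well_moded_clause m c"
      using P by (simp_all add: wf_program_def well_moded_program_def)
    with pos resolvent.IH show ?thesis
      using clause_resolvent_wf_well_moded[OF pos(3)] by simp
  next
    \<comment> \<open>A ground literal outputs no variables, so dropping it takes nothing away from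
      the rest of the query.\<close>
    case (neg A s)
    then show ?thesis
      using resolvent.IH by (simp add: wf_query_def well_moded_query_iff out_vars_ground)
  qed
next
  case (subsidiary_root A K)
  then show ?case
    by (simp add: wf_query_def well_moded_query_iff in_vars_ground)
qed

lemma bounded_if_in_vars_empty:
  assumes lev: "moded_level_mapping L m P lev"
    and A: "wf_atom L A" "in_vars m A = {}" "pred A \<in> rels P"
  shows "bounded L lev A"
proof -
  let ?S = "{\<sigma> \<in> substs L. ground (subst_atom \<sigma> A)}"
  have base: "subst_atom \<sigma> A \<in> herbrand_base L P" if "\<sigma> \<in> ?S" for \<sigma>
    using that A wf_atom_subst[of L A \<sigma>] by (auto simp: herbrand_base_def subst_atom_def)
  \<comment> \<open>No variables occur in the input arguments, so every substitution fixes
    them.\<close>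
  have inputs: "args (subst_atom \<sigma> A) ! i = args A ! i" if "i \<in> positions m In A" for \<sigma> i
    using that A(2) by (auto simp: in_vars_def positions_def subst_atom_def subst_trm_ground)
  have same: "lev (subst_atom \<sigma> A) = lev (subst_atom \<tau> A)" if "\<sigma> \<in> ?S" "\<tau> \<in> ?S" for \<sigma> \<tau>
  proof -
    have "pred (subst_atom \<sigma> A) = pred (subst_atom \<tau> A) \<and>
        (\<forall>i\<in>positions m In (subst_atom \<sigma> A). args (subst_atom \<sigma> A) ! i = args (subst_atom \<tau> A) ! i)"
      unfolding positions_subst using inputs by (metis subst_atom_def atom.sel(1))
    then show ?thesis
      by (rule lev[unfolded moded_level_mapping_def, rule_format, OF base[OF that(1)] base[OF that(2)]])
  qed
  have "finite ((\<lambda>\<sigma>. lev (subst_atom \<sigma> A)) ` ?S)"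
  \<comment> \<open>If some grounding \<open>\<tau>\<close> exists, its level is the only value
    attained; otherwise there are no values at all.\<close>
  proof (cases "?S = {}")
    case True
    then show ?thesis by (simp only: image_empty finite.emptyI)
  next
    case False
    then obtain \<tau> where "\<tau> \<in> ?S" by blast
    then have "(\<lambda>\<sigma>. lev (subst_atom \<sigma> A)) ` ?S \<subseteq> {lev (subst_atom \<tau> A)}"
      using same by blast
    then show ?thesis using finite_subset by blast
  qed
  moreover have "{lev (subst_atom \<sigma> A) |\<sigma>. \<sigma> \<in> substs L \<and> ground (subst_atom \<sigma> A)}
      = (\<lambda>\<sigma>. lev (subst_atom \<sigma> A)) ` ?S"
    by blast
  ultimately show ?thesis by (simp add: bounded_def)
qed

theorem proposition22:
  fixes L :: "('f, 'p) language" and m :: "'p moding" and n :: nat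
    and R :: "nat \<Rightarrow> ('f, 'p) program" and lev :: "nat \<Rightarrow> ('f, 'p) level_mapping"
    and Q :: "('f, 'p) query"
  assumes "\<exists>c. fun_arity L c = 0"
    and "\<And>i. i \<in> {1..n} \<Longrightarrow> wf_program L (R i)"
    and "well_moded_program m (\<Union>i\<in>{1..n}. R i)"
    and "hierarchy n R"
    and "\<And>i. i \<in> {1..n} \<Longrightarrow> moded_level_mapping L m (R i) (lev i)"
    and "wf_query L Q"
    and "well_moded_query m Q"
  shows "strongly_bounded L n R lev Q"
  unfolding strongly_bounded_def
proof (intro allI impI ballI)
  let ?P = "\<Union>i\<in>{1..n}. R i"
  fix A i
  assume call: "Pos A \<in> call L ?P Q" and i: "i \<in> {1..n}" and def: "pred A \<in> defined_rels (R i)"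
  have P: "wf_program L ?P"
    using assms(2) unfolding wf_program_def by blast
  from call obtain Q' where "Pos A = hd Q'" "Q' \<in> ldnf_descendants L ?P Q - {[]}"
    unfolding call_def by (rule imageE)
  then have Q': "Q' \<in> ldnf_descendants L ?P Q" "Q' \<noteq> []" "hd Q' = Pos A"
    by simp_all
  then obtain K where "Q' = Pos A # K"
    by (metis list.collapse)
  then have "wf_query L (Pos A # K) \<and> well_moded_query m (Pos A # K)"
    using ldnf_descendants_wf_well_moded[OF Q'(1) P assms(3,6,7)] by simp
  then have "wf_atom L A" "in_vars m A = {}"
    by (simp_all add: wf_query_def well_moded_query_iff)
  \<comment> \<open>This puts the ground instances of \<open>A\<close> into the Herbrand base of
    \<open>R i\<close> itself, the set on which \<open>lev i\<close> is known to be moded.\<close>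
  moreover have "pred A \<in> rels (R i)"
    using def by (auto simp: defined_rels_def rels_def)
  ultimately show "bounded L (lev i) A"
    using bounded_if_in_vars_empty assms(5)[OF i] by blast
qed

end
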